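(* Let $N\ge2$, $1<p<\infty$, $\alpha,b,c\in\mathbb{R}$, $D:=b+\big(\frac{N-2+c}{2}\big)^2>0$ and $$N\Big(\frac12-\frac1p\Big)+1+\frac c2-\sqrt D<\alpha<N\Big(\frac12-\frac1p\Big)+1+\frac c2+\sqrt D.$$ Let $$C:=b+\Big(\frac Np-2+\alpha\Big)\Big(\frac N{p'}-\alpha+c\Big),\qquad \frac1p+\frac1{p'}=1 .$$ Then there exists a constant $\kappa>0$, independent of $R>0$, such that for every $R>0$ and every $u\in\mathcal{D}_R$ $$\||x|^\alpha Lu\|_p^p-C^p\,\||x|^{\alpha-2}u\|_p^p\ \ge\ \kappa\,\big\||x|^{\alpha-2}\big|\log|R^{-1}x|\big|^{-\frac2p}u\big\|_p^p .$$
   Context: $L=\Delta+c\frac{x}{|x|^2}\cdot\nabla-\frac{b}{|x|^2}$ on $\mathbb{R}^N$; $\|\cdot\|_p$ is the norm of $L^p(\mathbb{R}^N)$. For $R>0$, $$\mathcal{D}_R=\{u\in C^2(\mathbb{R}^N):\ u=0\text{ in a neighborhood of }0,\ \operatorname{supp}u\subset B_{R/2}\},$$ where $B_r$ is the ball of center $0$ and radius $r$. *)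

theory Defs
  imports "HOL-Analysis.Analysis"
begin

text \<open>Partial derivative in the direction of the vector \<open>i\<close>; used for functions that are
  Frechet differentiable, with \<open>i\<close> ranging over the orthonormal basis.\<close>

definition partial_deriv ::
    "'a::euclidean_space \<Rightarrow> ('a \<Rightarrow> real) \<Rightarrow> 'a \<Rightarrow> real" where
  "partial_deriv i f x = frechet_derivative f (at x) i"

definition grad :: "('a::euclidean_space \<Rightarrow> real) \<Rightarrow> 'a \<Rightarrow> 'a" where
  "grad f x = (\<Sum>i\<in>Basis. partial_deriv i f x *\<^sub>R i)"

definition laplacian :: "('a::euclidean_space \<Rightarrow> real) \<Rightarrow> 'a \<Rightarrow> real" where
  "laplacian f x = (\<Sum>i\<in>Basis. partial_deriv i (partial_deriv i f) x)"

text \<open>Class \<open>C\<^sup>2\<close>: continuity of the function and of its first partial derivatives is implied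
  by differentiability.\<close>

definition C2 :: "('a::euclidean_space \<Rightarrow> real) \<Rightarrow> bool" where
  "C2 f \<longleftrightarrow>
     (\<forall>x. f differentiable (at x)) \<and>
     (\<forall>i\<in>Basis. \<forall>x. partial_deriv i f differentiable (at x)) \<and>
     (\<forall>i\<in>Basis. \<forall>j\<in>Basis. continuous_on UNIV (partial_deriv j (partial_deriv i f)))"

text \<open>The singular coefficients take the value 0 at the origin. This is harmless, since the
  operator is only applied to functions vanishing in a neighbourhood of 0.\<close>

definition L_op ::
    "real \<Rightarrow> real \<Rightarrow> ('a::euclidean_space \<Rightarrow> real) \<Rightarrow> 'a \<Rightarrow> real" where
  "L_op b c u x =
     laplacian u x + c * (((1 / (norm x)\<^sup>2) *\<^sub>R x) \<bullet> grad u x) - b / (norm x)\<^sup>2 * u x"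

text \<open>The \<open>L\<^sup>p\<close> norm is meaningful for \<open>f\<close> measurable with \<open>\<bar>f\<bar>\<^sup>p\<close> integrable (otherwise the
  integral is 0 by convention). For \<open>u\<close> in the class \<open>D_class R\<close> below this holds for every
  function whose norm is considered: it is continuous, with compact support in
  \<open>ball 0 (R / 2)\<close> not containing the origin, and on that ball \<open>\<bar>ln (norm x / R)\<bar> > ln 2\<close>
  away from 0.\<close>

definition Lp_norm :: "real \<Rightarrow> ('a::euclidean_space \<Rightarrow> real) \<Rightarrow> real" where
  "Lp_norm p f = (\<integral>x. \<bar>f x\<bar> powr p \<partial>lborel) powr (1 / p)"

definition D_class :: "real \<Rightarrow> ('a::euclidean_space \<Rightarrow> real) set" where
  "D_class R =
     {u. C2 u \<and> (\<forall>\<^sub>F x in nhds 0. u x = 0) \<and> closure {x. u x \<noteq> 0} \<subseteq> ball 0 (R / 2)}"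

end

theory Submission
  imports Defs
begin

text \<open>
  Write \<open>r = |x|\<close>, \<open>s = N/p - 2 + \<alpha>\<close> and \<open>\<beta> = (\<alpha> - 2) p + 2\<close>. Then
  \<open>C = b + s (N - 2 + c - s) = D - (s - (N - 2 + c)/2)\<^sup>2\<close>, so the two bounds on \<open>\<alpha>\<close> say exactly
  that \<open>C > 0\<close>.

  The inequality between \<open>p\<close>-th powers reduces to one that is linear in \<open>L u\<close>. Convexity of
  \<open>t \<mapsto> t\<^sup>p\<close> (\<open>powr_gap_ge_duality_pairing\<close>), applied pointwise to \<open>- r\<^sup>\<alpha> L u\<close> and
  \<open>r\<^bsup>\<alpha>-2\<^esup> u\<close>, leaves the dual estimate
  \<open>\<integral> r\<^sup>\<beta> (- L u) |u|\<^bsup>p-2\<^esup> u \<ge> \<integral> r\<^bsup>\<beta>-2\<^esup> (C + \<gamma> / \<ell>\<^sup>2) |u|\<^sup>p\<close> with \<open>\<ell> = ln (r/R)\<close> and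
  \<open>\<gamma> = (p - 1)/p\<^sup>2\<close>, and the constant of the theorem is \<open>p C\<^bsup>p-1\<^esup> \<gamma>\<close>.

  For the dual estimate, let \<open>\<phi> = |u|\<^bsup>p-2\<^esup> u\<close> and \<open>\<Phi> = |u|\<^sup>p / p\<close> be functions of the value of \<open>u\<close>,
  so that \<open>\<Phi>' = \<phi>\<close>. Green's identity (\<open>integral_green\<close>) turns the Laplacian into
  \<open>\<phi>' |\<nabla>u|\<^sup>2\<close> plus a drift term in \<open>x \<bullet> \<nabla>u\<close>. Part of the drift is absorbed by completing a square,
  which costs \<open>h\<^sup>2 \<phi>\<^sup>2/\<phi>'\<close> for a radial function \<open>h\<close> that may be chosen freely; the rest is
  \<open>\<nabla>(\<Phi>(u))\<close> tested with a radial field, and its integral is known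
  (\<open>integral_radial_field\<close>). The choice \<open>h = (p - 1) s\<close> gives the constant \<open>C\<close>, and the perturbation
  \<open>h = (p - 1) (s - 1/(p \<ell>))\<close> gains \<open>\<gamma> / \<ell>\<^sup>2\<close> (\<open>optimal_coefficient\<close>), as in the proof of
  Hardy's inequality with a logarithmic remainder.

  For \<open>p < 2\<close> the function \<open>\<phi>\<close> is not differentiable at \<open>0\<close>. The argument is therefore run with
  \<open>\<phi>\<^sub>\<epsilon>(t) = t (t\<^sup>2 + \<epsilon>)\<^bsup>p/2-1\<^esup>\<close>, and \<open>\<epsilon> \<rightarrow> 0\<close> by dominated convergence
  (\<open>regularized_energy_inequality\<close>, \<open>energy_inequality\<close>). All integrals are over a compact set
  on which \<open>0 < r < R\<close>, so the singular weights are smooth there.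
\<close>

section \<open>Integration by parts for compactly supported functions\<close>

lemma integrable_compact_support:
  fixes g :: "'a::euclidean_space \<Rightarrow> real"
  assumes "compact K" "continuous_on K g" and out: "\<And>x. x \<notin> K \<Longrightarrow> g x = 0"
  shows "integrable lborel g"
proof -
  have "g = (\<lambda>x. indicator K x *\<^sub>R g x)"
    using out by (auto simp: fun_eq_iff indicator_def)
  then show ?thesis
    using borel_integrable_compact[OF assms(1,2)] by simp
qed

lemma has_derivative_zero_off_closed_support:
  fixes g :: "'a::euclidean_space \<Rightarrow> real"
  assumes "closed K" and out: "\<And>x. x \<notin> K \<Longrightarrow> g x = 0" and "x \<notin> K"
    and der: "(g has_derivative g') (at x)"
  shows "g' v = 0"
proof -
  have "((\<lambda>x. 0) has_derivative g') (at x)"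
    using has_derivative_transform_within_open[OF der, of "- K" "\<lambda>x. 0"] assms by auto
  then have "g' = (\<lambda>v. 0)"
    using has_derivative_unique has_derivative_const by blast
  then show ?thesis by simp
qed

text \<open>
  The difference quotients of \<open>g\<close> in direction \<open>e\<close> have integral \<open>0\<close> by translation invariance of
  Lebesgue measure. By the mean value theorem they are bounded by the maximum of the derivative,
  and they live on one bounded set, so dominated convergence applies.
\<close>

lemma integral_directional_derivative_eq_0:
  fixes g :: "'a::euclidean_space \<Rightarrow> real"
  assumes "compact K" and out: "\<And>x. x \<notin> K \<Longrightarrow> g x = 0"
    and der: "\<And>x. (g has_derivative g' x) (at x)"
    and cont: "continuous_on UNIV (\<lambda>x. g' x e)"
  shows "(\<integral>x. g' x e \<partial>lborel) = 0"
proof -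
  have closed: "closed K" using \<open>compact K\<close> by (rule compact_imp_closed)
  have out': "g' x e = 0" if "x \<notin> K" for x
    using has_derivative_zero_off_closed_support[OF closed out that der] .
  obtain M where M: "\<And>x. \<bar>g' x e\<bar> \<le> M" "0 \<le> M"
  proof -
    have "compact ((\<lambda>x. g' x e) ` K)"
      by (rule compact_continuous_image[OF continuous_on_subset[OF cont] \<open>compact K\<close>]) simp
    then obtain B where B: "\<And>x. x \<in> K \<Longrightarrow> \<bar>g' x e\<bar> \<le> B"
      using bounded_real compact_imp_bounded by (metis imageI)
    have "\<bar>g' x e\<bar> \<le> max B 0" for x
      using B[of x] out'[of x] by (cases "x \<in> K") auto
    then show ?thesis using that by (meson max.cobounded2)
  qed
  obtain r where r: "\<And>x. x \<in> K \<Longrightarrow> norm x \<le> r"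
    using \<open>compact K\<close> compact_imp_bounded bounded_iff by metis
  define q where "q n x = (g (x + (1 / real (Suc n)) *\<^sub>R e) - g x) * real (Suc n)" for n x
  have contg: "continuous_on UNIV g"
    by (intro continuous_at_imp_continuous_on ballI has_derivative_continuous[OF der])
  then have [measurable]: "g \<in> borel_measurable borel"
    by (rule borel_measurable_continuous_onI)
  have meas': "(\<lambda>x. g' x e) \<in> borel_measurable borel"
    using cont by (rule borel_measurable_continuous_onI)
  have intg: "integrable lborel g"
    by (rule integrable_compact_support[OF \<open>compact K\<close> continuous_on_subset[OF contg] out]) auto
  have line: "((\<lambda>t. g (x + t *\<^sub>R e)) has_real_derivative g' (x + t *\<^sub>R e) e) (at t)" for x t
  proof -
    have "((\<lambda>t. x + t *\<^sub>R e) has_derivative (\<lambda>s. s *\<^sub>R e)) (at t)"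
      by (auto intro!: derivative_eq_intros)
    from has_derivative_compose[OF this der]
    show ?thesis
      by (rule has_derivative_imp_has_field_derivative)
         (metis der has_derivative_linear linear_scale mult.commute real_scaleR_def)
  qed
  have q0: "(\<integral>x. q n x \<partial>lborel) = 0" for n
  proof -
    let ?s = "(1 / real (Suc n)) *\<^sub>R e"
    have "integrable lborel (\<lambda>x. g (?s + x))"
      using integrable_distr_eq[of "(+) ?s" lborel borel g] intg lborel_distr_plus[of ?s] by simp
    moreover have "(\<integral>x. g (?s + x) \<partial>lborel) = (\<integral>x. g x \<partial>lborel)"
      using integral_distr[of "(+) ?s" lborel borel g] lborel_distr_plus[of ?s] by simp
    ultimately show ?thesis
      using intg by (simp add: q_def add.commute)
  qed
  have "(\<lambda>n. \<integral>x. q n x \<partial>lborel) \<longlonglongrightarrow> (\<integral>x. g' x e \<partial>lborel)"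
  proof (rule integral_dominated_convergence)
    show "(\<lambda>x. g' x e) \<in> borel_measurable lborel" using meas' by simp
    show "q n \<in> borel_measurable lborel" for n unfolding q_def by measurable
    show "integrable lborel (\<lambda>x. indicator (cball (0::'a) (r + norm e)) x *\<^sub>R M)"
      by (intro borel_integrable_compact) auto
    show "AE x in lborel. (\<lambda>n. q n x) \<longlonglongrightarrow> g' x e"
    proof (rule AE_I2)
      fix x
      have "((\<lambda>t. (g (x + t *\<^sub>R e) - g x) / t) \<longlongrightarrow> g' x e) (at 0)"
        using line[of x 0] by (simp add: has_field_derivative_iff)
      moreover have "filterlim (\<lambda>n. 1 / real (Suc n)) (at 0) sequentially"
        using LIMSEQ_inverse_real_of_nat by (auto simp: filterlim_at inverse_eq_divide)
      ultimately have "((\<lambda>n. (g (x + (1 / real (Suc n)) *\<^sub>R e) - g x) / (1 / real (Suc n))) \<longlongrightarrow> g' x e) sequentially"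
        by (rule filterlim_compose)
      then show "(\<lambda>n. q n x) \<longlonglongrightarrow> g' x e" by (simp add: q_def)
    qed
    show "AE x in lborel. norm (q n x) \<le> indicator (cball (0::'a) (r + norm e)) x *\<^sub>R M" for n
    proof (rule AE_I2)
      fix x
      let ?t = "1 / real (Suc n)"
      have t: "0 < ?t" "?t \<le> 1" by auto
      show "norm (q n x) \<le> indicator (cball (0::'a) (r + norm e)) x *\<^sub>R M"
      proof (cases "x \<in> cball 0 (r + norm e)")
        case True
        obtain z where z: "g (x + ?t *\<^sub>R e) - g (x + 0 *\<^sub>R e) = (?t - 0) * g' (x + z *\<^sub>R e) e"
          using MVT2[OF t(1) line] by blast
        then have "q n x = g' (x + z *\<^sub>R e) e" by (simp add: q_def)
        then show ?thesis using True M by simp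
      next
        case False
        have "norm (?t *\<^sub>R e) \<le> norm e"
          using t by (simp add: divide_le_eq mult_le_cancel_left1)
        then have "norm (x + ?t *\<^sub>R e) > r"
          using False norm_triangle_ineq4[of "x + ?t *\<^sub>R e" "?t *\<^sub>R e"] by simp
        moreover have "norm x > r" using False norm_ge_zero[of e] by (simp del: norm_ge_zero)
        ultimately have "g x = 0" "g (x + ?t *\<^sub>R e) = 0" using out r by (meson not_le)+
        then show ?thesis using False by (simp add: q_def)
      qed
    qed
  qed
  then show ?thesis
    by (simp add: q0 LIMSEQ_const_iff)
qed

text \<open>
  Integration by parts. Only \<open>g\<close> is compactly supported; \<open>f\<close> may be singular off \<open>U\<close>, which is
  what lets negative powers of the norm appear as weights.
\<close>

lemma integral_partial_product:
  fixes f g :: "'a::euclidean_space \<Rightarrow> real"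
  assumes "open U" "compact K" "K \<subseteq> U" and out: "\<And>x. x \<notin> K \<Longrightarrow> g x = 0"
    and f: "\<And>x. x \<in> U \<Longrightarrow> (f has_derivative f' x) (at x)"
    and f': "continuous_on U (\<lambda>x. f' x e)"
    and g: "\<And>x. (g has_derivative g' x) (at x)"
    and g': "continuous_on UNIV (\<lambda>x. g' x e)"
  shows "integrable lborel (\<lambda>x. f x * g' x e)" "integrable lborel (\<lambda>x. f' x e * g x)"
    "(\<integral>x. f x * g' x e \<partial>lborel) = - (\<integral>x. f' x e * g x \<partial>lborel)"
proof -
  have closed: "closed K" using \<open>compact K\<close> by (rule compact_imp_closed)
  have out': "g' x v = 0" if "x \<notin> K" for x v
    using has_derivative_zero_off_closed_support[OF closed out that g] .
  have cf: "continuous_on U f"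
    by (intro continuous_at_imp_continuous_on ballI has_derivative_continuous[OF f])
  have cg: "continuous_on UNIV g"
    by (intro continuous_at_imp_continuous_on ballI has_derivative_continuous[OF g])
  have cU: "continuous_on U (\<lambda>x. f x * g' x e)" "continuous_on U (\<lambda>x. f' x e * g x)"
    using cf f' continuous_on_subset[OF cg] continuous_on_subset[OF g']
    by (auto intro!: continuous_intros)
  show i1: "integrable lborel (\<lambda>x. f x * g' x e)"
    using cU continuous_on_subset \<open>K \<subseteq> U\<close> out' by (intro integrable_compact_support[OF \<open>compact K\<close>]) auto
  show i2: "integrable lborel (\<lambda>x. f' x e * g x)"
    using cU continuous_on_subset \<open>K \<subseteq> U\<close> out by (intro integrable_compact_support[OF \<open>compact K\<close>]) auto
  \<comment> \<open>The product is extended by zero: off \<open>K\<close> it vanishes identically, whatever \<open>f\<close> is there.\<close>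
  define h where "h x = f x * g x" for x
  define h' where "h' x = (if x \<in> U then (\<lambda>v. f x * g' x v + f' x v * g x) else (\<lambda>v. 0))" for x
  have h'_eq: "h' x e = f x * g' x e + f' x e * g x" for x
    using subsetD[OF \<open>K \<subseteq> U\<close>, of x] by (cases "x \<in> K") (simp_all add: h'_def out out')
  have hout: "h x = 0" if "x \<notin> K" for x using that out by (simp add: h_def)
  have hder: "(h has_derivative h' x) (at x)" for x
  proof (cases "x \<in> U")
    case True
    then show ?thesis unfolding h_def h'_def
      using has_derivative_mult[OF f[OF True] g] by simp
  next
    case False
    then have "x \<in> - K" using \<open>K \<subseteq> U\<close> by auto
    have zero: "((\<lambda>_. 0::real) has_derivative (\<lambda>v. 0)) (at x)" by simp
    have "(h has_derivative (\<lambda>v. 0)) (at x)"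
      using has_derivative_transform_within_open[OF zero, of "- K" h] closed hout \<open>x \<in> - K\<close>
      by auto
    then show ?thesis using False by (simp add: h'_def)
  qed
  have hcont: "continuous_on UNIV (\<lambda>x. h' x e)"
  proof -
    have "continuous_on U (\<lambda>x. h' x e)" unfolding h'_eq using cU by (rule continuous_on_add)
    moreover have "continuous_on (- K) (\<lambda>x. h' x e)"
      using continuous_on_cong[of "- K" "- K" "\<lambda>x. h' x e" "\<lambda>x. 0"] out out' by (simp add: h'_eq)
    ultimately have "continuous_on (U \<union> - K) (\<lambda>x. h' x e)"
      using \<open>open U\<close> closed by (intro continuous_on_open_Un) auto
    moreover have "U \<union> - K = UNIV" using \<open>K \<subseteq> U\<close> by auto
    ultimately show ?thesis by simp
  qed
  have "(\<integral>x. h' x e \<partial>lborel) = 0"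
    by (rule integral_directional_derivative_eq_0[where g = h and K = K])
      (fact \<open>compact K\<close> hout hder hcont)+
  then show "(\<integral>x. f x * g' x e \<partial>lborel) = - (\<integral>x. f' x e * g x \<partial>lborel)"
    using i1 i2 by (simp add: h'_eq)
qed

section \<open>Functions of class \<open>C\<^sup>2\<close>\<close>

lemma grad_inner_Basis: "i \<in> Basis \<Longrightarrow> grad u x \<bullet> i = partial_deriv i u x"
  by (simp add: grad_def)

lemma linear_eq_sum_Basis:
  fixes f :: "'a::euclidean_space \<Rightarrow> real"
  assumes "linear f"
  shows "f v = (\<Sum>i\<in>Basis. (v \<bullet> i) * f i)"
proof -
  have "f v = f (\<Sum>i\<in>Basis. (v \<bullet> i) *\<^sub>R i)" by (simp add: euclidean_representation)
  also have "\<dots> = (\<Sum>i\<in>Basis. (v \<bullet> i) * f i)"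
    by (simp add: linear_sum[OF assms] linear_scale[OF assms])
  finally show ?thesis .
qed

lemma C2_has_derivative:
  assumes "C2 u"
  shows "(u has_derivative (\<lambda>v. v \<bullet> grad u x)) (at x)"
proof -
  have d: "(u has_derivative frechet_derivative u (at x)) (at x)"
    using assms by (simp add: C2_def frechet_derivative_works)
  have "frechet_derivative u (at x) v = v \<bullet> grad u x" for v
    unfolding linear_eq_sum_Basis[OF has_derivative_linear[OF d], of v]
    by (simp add: grad_def inner_sum_right partial_deriv_def mult.commute)
  then have "frechet_derivative u (at x) = (\<lambda>v. v \<bullet> grad u x)" by (rule ext)
  then show ?thesis using d by simp
qed

lemma C2_partial_has_derivative:
  assumes "C2 u" "i \<in> Basis"
  shows "(partial_deriv i u has_derivative frechet_derivative (partial_deriv i u) (at x)) (at x)"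
  using assms by (simp add: C2_def frechet_derivative_works)

lemma C2_continuous: "C2 u \<Longrightarrow> continuous_on S u"
  by (intro continuous_at_imp_continuous_on ballI has_derivative_continuous[OF C2_has_derivative])

lemma C2_continuous_partial: "C2 u \<Longrightarrow> i \<in> Basis \<Longrightarrow> continuous_on S (partial_deriv i u)"
  by (intro continuous_at_imp_continuous_on ballI
      has_derivative_continuous[OF C2_partial_has_derivative])

lemma C2_continuous_second_partial:
  "C2 u \<Longrightarrow> i \<in> Basis \<Longrightarrow> j \<in> Basis \<Longrightarrow> continuous_on S (partial_deriv j (partial_deriv i u))"
  unfolding C2_def by (rule continuous_on_subset[of UNIV]) auto

lemma C2_continuous_grad: "C2 u \<Longrightarrow> continuous_on S (grad u)"
  unfolding grad_def by (intro continuous_intros C2_continuous_partial)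

lemma C2_continuous_laplacian: "C2 u \<Longrightarrow> continuous_on S (laplacian u)"
  unfolding laplacian_def by (intro continuous_intros C2_continuous_second_partial)

lemma C2_continuous_L_op:
  assumes "C2 u" "0 \<notin> S"
  shows "continuous_on S (L_op b c u)"
  unfolding L_op_def[abs_def]
  using assms
  by (intro continuous_intros C2_continuous C2_continuous_grad C2_continuous_laplacian) auto

lemma L_op_zero_off_support:
  assumes "closed K" "C2 u" and out: "\<And>x. x \<notin> K \<Longrightarrow> u x = 0" and "x \<notin> K"
  shows "L_op b c u x = 0"
proof -
  have vanish: "partial_deriv i u y = 0" if "y \<notin> K" for i y
    unfolding partial_deriv_def
    using has_derivative_zero_off_closed_support[OF \<open>closed K\<close> out that]
      \<open>C2 u\<close> by (simp add: C2_def frechet_derivative_works)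
  have "partial_deriv i (partial_deriv i u) x = 0" if "i \<in> Basis" for i
    unfolding partial_deriv_def[of i "partial_deriv i u"]
    by (rule has_derivative_zero_off_closed_support[OF \<open>closed K\<close> vanish \<open>x \<notin> K\<close>
          C2_partial_has_derivative[OF \<open>C2 u\<close> that]])
  then show ?thesis
    using vanish[OF \<open>x \<notin> K\<close>] out[OF \<open>x \<notin> K\<close>] by (simp add: L_op_def laplacian_def grad_def)
qed

lemma D_class_support:
  fixes u :: "'a::euclidean_space \<Rightarrow> real"
  assumes "0 < R" "u \<in> D_class R"
  obtains K where "compact K" "K \<subseteq> {x. 0 < norm x \<and> norm x < R}" "\<And>x. x \<notin> K \<Longrightarrow> u x = 0"
proof
  let ?K = "closure {x. u x \<noteq> 0}"
  have sub: "?K \<subseteq> ball 0 (R / 2)" using assms by (simp add: D_class_def)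
  then show "compact ?K"
    using bounded_subset[OF bounded_ball] by (auto simp: compact_eq_bounded_closed)
  have "0 \<notin> ?K"
  proof -
    have "\<forall>\<^sub>F x in nhds 0. u x = 0" using assms by (simp add: D_class_def)
    then obtain S where "open S" "0 \<in> S" "\<forall>x\<in>S. u x = 0"
      by (auto simp: eventually_nhds)
    then have "S \<inter> {x. u x \<noteq> 0} = {}" by auto
    then show ?thesis using \<open>open S\<close> \<open>0 \<in> S\<close> open_Int_closure_eq_empty by blast
  qed
  then show "?K \<subseteq> {x. 0 < norm x \<and> norm x < R}"
  proof (intro subsetI CollectI conjI)
    fix x assume x: "x \<in> ?K"
    show "0 < norm x" using x \<open>0 \<notin> ?K\<close> by (cases "x = 0") auto
    show "norm x < R" using subsetD[OF sub x] \<open>0 < R\<close> by simp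
  qed
  show "u x = 0" if "x \<notin> ?K" for x
    using that closure_subset[of "{x. u x \<noteq> 0}"] by auto
qed

section \<open>Two divergence identities\<close>

text \<open>
  Green's identity: \<open>G\<close> is the divergence of \<open>a \<phi>(u) \<nabla>u\<close>.
\<close>

lemma integral_green:
  fixes u a :: "'a::euclidean_space \<Rightarrow> real"
  assumes "open U" "compact K" "K \<subseteq> U" and u: "C2 u" and out: "\<And>x. x \<notin> K \<Longrightarrow> u x = 0"
    and a: "\<And>x. x \<in> U \<Longrightarrow> (a has_derivative a' x) (at x)"
    and a': "\<And>i. i \<in> Basis \<Longrightarrow> continuous_on U (\<lambda>x. a' x i)"
    and \<phi>: "\<And>t. (\<phi> has_real_derivative \<phi>' t) (at t)" and \<phi>': "continuous_on UNIV \<phi>'"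
    and \<phi>0: "\<phi> 0 = 0"
  defines "G \<equiv> \<lambda>x. a x * \<phi> (u x) * laplacian u x + a x * \<phi>' (u x) * (norm (grad u x))\<^sup>2
                     + \<phi> (u x) * a' x (grad u x)"
  shows "integrable lborel G" "(\<integral>x. G x \<partial>lborel) = 0"
proof -
  define g' where "g' i x v = \<phi> (u x) * frechet_derivative (partial_deriv i u) (at x) v
      + (v \<bullet> grad u x) * \<phi>' (u x) * partial_deriv i u x" for i x v
  have g'_i: "g' i x i = \<phi> (u x) * partial_deriv i (partial_deriv i u) x
      + \<phi>' (u x) * (partial_deriv i u x)\<^sup>2" if "i \<in> Basis" for i x
    using that by (simp add: g'_def partial_deriv_def[of i "partial_deriv i u"]
        inner_commute[of i] grad_inner_Basis power2_eq_square)
  have g: "((\<lambda>x. \<phi> (u x) * partial_deriv i u x) has_derivative g' i x) (at x)"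
    if "i \<in> Basis" for i x
  proof -
    have "((\<lambda>x. \<phi> (u x)) has_derivative (\<lambda>v. (v \<bullet> grad u x) * \<phi>' (u x))) (at x)"
      using DERIV_compose_FDERIV[OF \<phi> C2_has_derivative[OF u]] by simp
    from has_derivative_mult[OF this C2_partial_has_derivative[OF u that]]
    show ?thesis by (simp add: g'_def[abs_def])
  qed
  have c\<phi>: "continuous_on UNIV \<phi>"
    by (intro continuous_at_imp_continuous_on ballI DERIV_isCont[OF \<phi>])
  have cg: "continuous_on UNIV (\<lambda>x. g' i x i)" if "i \<in> Basis" for i
    unfolding g'_i[OF that]
    by (intro continuous_intros C2_continuous_partial C2_continuous_second_partial u that
        continuous_on_compose2[OF c\<phi> C2_continuous[OF u]]
        continuous_on_compose2[OF \<phi>' C2_continuous[OF u]]) auto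
  have parts: "integrable lborel (\<lambda>x. a x * g' i x i)"
    "integrable lborel (\<lambda>x. a' x i * (\<phi> (u x) * partial_deriv i u x))"
    "(\<integral>x. a x * g' i x i \<partial>lborel) = - (\<integral>x. a' x i * (\<phi> (u x) * partial_deriv i u x) \<partial>lborel)"
    if "i \<in> Basis" for i
    using integral_partial_product[OF assms(1-3) _ a a'[OF that] g[OF that] cg[OF that]]
    by (auto simp: out \<phi>0)
  have G_eq: "G x = (\<Sum>i\<in>Basis. a x * g' i x i + a' x i * (\<phi> (u x) * partial_deriv i u x))" for x
  proof -
    have lap: "(\<Sum>i\<in>Basis. a x * g' i x i)
        = a x * \<phi> (u x) * laplacian u x + a x * \<phi>' (u x) * (norm (grad u x))\<^sup>2"
    proof -
      have "(norm (grad u x))\<^sup>2 = (\<Sum>i\<in>Basis. (partial_deriv i u x)\<^sup>2)"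
        unfolding power2_norm_eq_inner
        by (subst euclidean_inner) (simp add: grad_inner_Basis power2_eq_square)
      then show ?thesis
        by (simp add: g'_i laplacian_def sum_distrib_left sum.distrib algebra_simps)
    qed
    have "(\<Sum>i\<in>Basis. a' x i * (\<phi> (u x) * partial_deriv i u x)) = \<phi> (u x) * a' x (grad u x)"
    proof (cases "x \<in> U")
      case True
      have "a' x (grad u x) = (\<Sum>i\<in>Basis. partial_deriv i u x * a' x i)"
        using linear_eq_sum_Basis[OF has_derivative_linear[OF a[OF True]], of "grad u x"]
        by (simp add: grad_inner_Basis)
      then show ?thesis by (simp add: sum_distrib_left algebra_simps)
    next
      case False
      then have "u x = 0" using out \<open>K \<subseteq> U\<close> by blast
      then show ?thesis by (simp add: \<phi>0)
    qed
    with lap show ?thesis by (simp add: G_def sum.distrib)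
  qed
  show "integrable lborel G"
    unfolding G_eq[abs_def] using parts by (intro Bochner_Integration.integrable_sum) auto
  show "(\<integral>x. G x \<partial>lborel) = 0"
    unfolding G_eq using parts by (subst Bochner_Integration.integral_sum) auto
qed

text \<open>
  Here \<open>G\<close> is the divergence of \<open>k(x) \<Phi>(u) x\<close>; the divergence of \<open>k(x) x\<close> is the radial derivative
  \<open>k' x x\<close> plus \<open>k x\<close> times the dimension.
\<close>

lemma integral_radial_field:
  fixes u k :: "'a::euclidean_space \<Rightarrow> real"
  assumes "open U" "compact K" "K \<subseteq> U" and u: "C2 u" and out: "\<And>x. x \<notin> K \<Longrightarrow> u x = 0"
    and k: "\<And>x. x \<in> U \<Longrightarrow> (k has_derivative k' x) (at x)"
    and k': "\<And>i. i \<in> Basis \<Longrightarrow> continuous_on U (\<lambda>x. k' x i)"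
    and \<Phi>: "\<And>t. (\<Phi> has_real_derivative \<phi> t) (at t)" and \<phi>: "continuous_on UNIV \<phi>"
    and \<Phi>0: "\<Phi> 0 = 0"
  defines "G \<equiv> \<lambda>x. k x * \<phi> (u x) * (x \<bullet> grad u x) + (k' x x + real DIM('a) * k x) * \<Phi> (u x)"
  shows "integrable lborel G" "(\<integral>x. G x \<partial>lborel) = 0"
proof -
  define f' where "f' i x v = k x * (v \<bullet> i) + k' x v * (x \<bullet> i)" for i x v
  have f: "((\<lambda>x. k x * (x \<bullet> i)) has_derivative f' i x) (at x)" if "x \<in> U" for i x
    using has_derivative_mult[OF k[OF that] has_derivative_inner_left[OF has_derivative_ident], of i]
    by (simp add: f'_def[abs_def])
  have ck: "continuous_on U k"
    by (intro continuous_at_imp_continuous_on ballI has_derivative_continuous[OF k])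
  have cf: "continuous_on U (\<lambda>x. f' i x i)" if "i \<in> Basis" for i
    unfolding f'_def by (intro continuous_intros ck k' that)
  have g: "((\<lambda>x. \<Phi> (u x)) has_derivative (\<lambda>v. (v \<bullet> grad u x) * \<phi> (u x))) (at x)" for x
    using DERIV_compose_FDERIV[OF \<Phi> C2_has_derivative[OF u]] by simp
  have cg: "continuous_on UNIV (\<lambda>x. (i \<bullet> grad u x) * \<phi> (u x))" for i
    by (intro continuous_intros C2_continuous_grad[OF u]
        continuous_on_compose2[OF \<phi> C2_continuous[OF u]]) auto
  have parts: "integrable lborel (\<lambda>x. k x * (x \<bullet> i) * ((i \<bullet> grad u x) * \<phi> (u x)))"
    "integrable lborel (\<lambda>x. f' i x i * \<Phi> (u x))"
    "(\<integral>x. k x * (x \<bullet> i) * ((i \<bullet> grad u x) * \<phi> (u x)) \<partial>lborel) = - (\<integral>x. f' i x i * \<Phi> (u x) \<partial>lborel)"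
    if "i \<in> Basis" for i
    using integral_partial_product[OF assms(1-3) _ f cf[OF that] g cg]
    by (auto simp: out \<Phi>0)
  have G_eq: "G x = (\<Sum>i\<in>Basis. k x * (x \<bullet> i) * ((i \<bullet> grad u x) * \<phi> (u x)) + f' i x i * \<Phi> (u x))" for x
  proof -
    have "x \<bullet> grad u x = (\<Sum>i\<in>Basis. (x \<bullet> i) * (i \<bullet> grad u x))"
      by (subst euclidean_inner) (simp add: inner_commute)
    then have 1: "(\<Sum>i\<in>Basis. k x * (x \<bullet> i) * ((i \<bullet> grad u x) * \<phi> (u x))) = k x * \<phi> (u x) * (x \<bullet> grad u x)"
      by (simp add: sum_distrib_left algebra_simps)
    have 2: "(\<Sum>i\<in>Basis. f' i x i * \<Phi> (u x)) = (k' x x + real DIM('a) * k x) * \<Phi> (u x)"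
    proof (cases "x \<in> U")
      case True
      have "(\<Sum>i\<in>Basis. f' i x i) = k' x x + real DIM('a) * k x"
        using linear_eq_sum_Basis[OF has_derivative_linear[OF k[OF True]], of x]
        by (simp add: f'_def sum.distrib mult.commute)
      then show ?thesis by (metis sum_distrib_right)
    next
      case False
      then have "u x = 0" using out \<open>K \<subseteq> U\<close> by blast
      then show ?thesis by (simp add: \<Phi>0)
    qed
    from 1 2 show ?thesis by (simp add: G_def sum.distrib)
  qed
  show "integrable lborel G"
    unfolding G_eq[abs_def] using parts by (intro Bochner_Integration.integrable_sum) auto
  show "(\<integral>x. G x \<partial>lborel) = 0"
    unfolding G_eq using parts by (subst Bochner_Integration.integral_sum) auto
qed

section \<open>Convexity of powers\<close>

text \<open>
  Young's inequality for \<open>A\<close> and \<open>t\<^bsup>p-1\<^esup>\<close>, rearranged: the graph of \<open>t \<mapsto> t\<^sup>p\<close> lies above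
  its tangents.
\<close>

lemma powr_tangent_le:
  fixes A t p :: real
  assumes "1 < p" "0 \<le> A" "0 \<le> t"
  shows "t powr p + p * t powr (p - 1) * (A - t) \<le> A powr p"
proof -
  have "A * t powr (p - 1) \<le> A powr p / p + (t powr (p - 1)) powr (p / (p - 1)) / (p / (p - 1))"
    using assms by (intro Youngs_inequality) (auto simp: field_simps)
  also have "(t powr (p - 1)) powr (p / (p - 1)) = t powr p"
    using assms by (simp add: powr_powr)
  finally have "p * (A * t powr (p - 1)) \<le> A powr p + (p - 1) * t powr p"
    using assms by (simp add: field_simps)
  moreover have "t powr (p - 1) * t = t powr p"
    using assms by (simp add: powr_mult_base mult.commute)
  ultimately show ?thesis by (simp add: algebra_simps)
qed

text \<open>
  The tangent at \<open>C |y|\<close>. It bounds a difference of \<open>p\<close>-th powers below by an expression linear in \<open>A\<close>,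
  and so takes the place of Hoelder's inequality without any division by a norm.
\<close>

lemma powr_gap_ge_duality_pairing:
  fixes A y C p :: real
  assumes "1 < p" "0 < C"
  shows "p * C powr (p - 1) * (A * sgn y * \<bar>y\<bar> powr (p - 1) - C * \<bar>y\<bar> powr p)
    \<le> \<bar>A\<bar> powr p - C powr p * \<bar>y\<bar> powr p"
proof -
  have "(C * \<bar>y\<bar>) powr p + p * (C * \<bar>y\<bar>) powr (p - 1) * (\<bar>A\<bar> - C * \<bar>y\<bar>) \<le> \<bar>A\<bar> powr p"
    using assms by (intro powr_tangent_le) auto
  moreover have "(C * \<bar>y\<bar>) powr q = C powr q * \<bar>y\<bar> powr q" for q
    using assms by (simp add: powr_mult)
  moreover have "p * C powr (p - 1) * (\<bar>y\<bar> powr (p - 1) * (A * sgn y)) \<le> p * C powr (p - 1) * (\<bar>y\<bar> powr (p - 1) * \<bar>A\<bar>)"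
  proof -
    have "A * sgn y \<le> \<bar>A\<bar>" by (cases y "0::real" rule: linorder_cases) auto
    then show ?thesis using assms by (intro mult_left_mono) auto
  qed
  ultimately have "p * C powr (p - 1) * (\<bar>y\<bar> powr (p - 1) * (A * sgn y))
      - p * C powr (p - 1) * (C * (\<bar>y\<bar> powr (p - 1) * \<bar>y\<bar>))
    \<le> \<bar>A\<bar> powr p - C powr p * \<bar>y\<bar> powr p"
    by (simp add: algebra_simps)
  moreover have y: "\<bar>y\<bar> powr (p - 1) * \<bar>y\<bar> = \<bar>y\<bar> powr p"
    using assms by (simp add: powr_mult_base mult.commute)
  ultimately show ?thesis unfolding y by (simp add: algebra_simps)
qed

lemma Lp_norm_powr:
  assumes "0 < p"
  shows "Lp_norm p f powr p = (\<integral>x. \<bar>f x\<bar> powr p \<partial>lborel)"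
  using assms by (simp add: Lp_norm_def powr_powr)

section \<open>A regularised power function\<close>

text \<open>
  A smooth replacement, for \<open>e > 0\<close>, of \<open>t \<mapsto> sgn t * \<bar>t\<bar> powr (p - 1)\<close>, together with its
  derivative and its primitive vanishing at \<open>0\<close>.
\<close>

definition reg_pow :: "real \<Rightarrow> real \<Rightarrow> real \<Rightarrow> real" where
  "reg_pow p e t = t * (t\<^sup>2 + e) powr (p / 2 - 1)"

definition reg_pow_deriv :: "real \<Rightarrow> real \<Rightarrow> real \<Rightarrow> real" where
  "reg_pow_deriv p e t = ((p - 1) * t\<^sup>2 + e) * (t\<^sup>2 + e) powr (p / 2 - 2)"

definition reg_pow_prim :: "real \<Rightarrow> real \<Rightarrow> real \<Rightarrow> real" where
  "reg_pow_prim p e t = ((t\<^sup>2 + e) powr (p / 2) - e powr (p / 2)) / p"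

lemma sum_square_pos: "0 < e \<Longrightarrow> 0 < t\<^sup>2 + (e::real)"
  by (simp add: add_nonneg_pos)

lemma reg_pow_has_derivative:
  assumes "0 < e"
  shows "(reg_pow p e has_real_derivative reg_pow_deriv p e t) (at t)"
proof -
  have pos: "0 < t\<^sup>2 + e" using assms by (rule sum_square_pos)
  have "(t\<^sup>2 + e) powr (p / 2 - 1) = (t\<^sup>2 + e) powr (1 + (p / 2 - 2))" by simp
  then have *: "(t\<^sup>2 + e) powr (p / 2 - 1) = (t\<^sup>2 + e) * (t\<^sup>2 + e) powr (p / 2 - 2)"
    using pos by (simp only: powr_add) simp
  have "((\<lambda>t. t\<^sup>2 + e) has_real_derivative 2 * t) (at t)"
    by (auto intro!: derivative_eq_intros)
  from DERIV_fun_powr[OF this pos, of "p / 2 - 1"]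
  have "((\<lambda>t. (t\<^sup>2 + e) powr (p / 2 - 1)) has_real_derivative
      (p / 2 - 1) * (t\<^sup>2 + e) powr (p / 2 - 2) * (2 * t)) (at t)"
    by simp
  from DERIV_mult[OF DERIV_ident this]
  have "(reg_pow p e has_real_derivative
      1 * (t\<^sup>2 + e) powr (p / 2 - 1)
        + (p / 2 - 1) * (t\<^sup>2 + e) powr (p / 2 - 2) * (2 * t) * t) (at t)"
    unfolding reg_pow_def[abs_def] .
  moreover have "1 * (t\<^sup>2 + e) powr (p / 2 - 1)
        + (p / 2 - 1) * (t\<^sup>2 + e) powr (p / 2 - 2) * (2 * t) * t = reg_pow_deriv p e t"
    unfolding * reg_pow_deriv_def
    by (simp only: left_diff_distrib distrib_right power2_eq_square) simp
  ultimately show ?thesis by simp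
qed

lemma reg_pow_prim_has_derivative:
  assumes "0 < e" "1 < p"
  shows "(reg_pow_prim p e has_real_derivative reg_pow p e t) (at t)"
proof -
  have pos: "0 < t\<^sup>2 + e" using assms(1) by (rule sum_square_pos)
  show ?thesis
    unfolding reg_pow_prim_def[abs_def] reg_pow_def
    by (rule derivative_eq_intros refl | use pos assms in simp)+
qed

lemma continuous_reg_pow_deriv:
  assumes "0 < e"
  shows "continuous_on S (reg_pow_deriv p e)"
proof -
  have "t\<^sup>2 + e \<noteq> 0" for t using sum_square_pos[OF assms, of t] by simp
  then show ?thesis
    unfolding reg_pow_deriv_def[abs_def] by (intro continuous_intros ballI)
qed

lemma continuous_reg_pow: "0 < e \<Longrightarrow> continuous_on S (reg_pow p e)"
  by (intro continuous_at_imp_continuous_on ballI DERIV_isCont[OF reg_pow_has_derivative])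

lemma reg_pow_deriv_pos:
  assumes "0 < e" "1 < p"
  shows "0 < reg_pow_deriv p e t"
proof -
  have "0 < (p - 1) * t\<^sup>2 + e" using assms by (intro add_nonneg_pos) auto
  moreover have "0 < (t\<^sup>2 + e) powr (p / 2 - 2)" using sum_square_pos[OF assms(1), of t] by simp
  ultimately show ?thesis by (simp add: reg_pow_deriv_def)
qed

text \<open>
  The left-hand side is the price of completing a square. In the form on the right it is visibly
  bounded uniformly in \<open>0 < e \<le> 1\<close> for each \<open>t\<close>, although for \<open>p > 2\<close> the denominator on the left
  tends to \<open>0\<close> at \<open>t = 0\<close> as \<open>e \<rightarrow> 0\<close>.
\<close>

lemma reg_pow_square_over_deriv:
  assumes "0 < e" "1 < p"
  shows "(reg_pow p e t)\<^sup>2 / reg_pow_deriv p e t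
    = t\<^sup>2 / ((p - 1) * t\<^sup>2 + e) * (t\<^sup>2 + e) powr (p / 2)"
proof -
  have pos: "0 < t\<^sup>2 + e" using assms(1) by (rule sum_square_pos)
  have "((t\<^sup>2 + e) powr (p / 2 - 1))\<^sup>2 = (t\<^sup>2 + e) powr (p / 2) * (t\<^sup>2 + e) powr (p / 2 - 2)"
    using pos by (simp add: power2_eq_square flip: powr_add)
  then show ?thesis
    using pos by (simp add: reg_pow_def reg_pow_deriv_def power_mult_distrib)
qed

lemma square_powr: "(t\<^sup>2) powr q = \<bar>t\<bar> powr (2 * q)" for t q :: real
proof -
  have "t\<^sup>2 = \<bar>t\<bar> powr 2" by simp
  then show ?thesis by (simp only: powr_powr)
qed

lemma reg_pow_limit:
  assumes "1 < p"
  shows "((\<lambda>e. reg_pow p e t) \<longlongrightarrow> sgn t * \<bar>t\<bar> powr (p - 1)) (at_right 0)"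
proof (cases "t = 0")
  case False
  have "((\<lambda>e. reg_pow p e t) \<longlongrightarrow> t * (t\<^sup>2 + 0) powr (p / 2 - 1)) (at_right 0)"
    unfolding reg_pow_def using False by (intro tendsto_intros) auto
  moreover have "(t\<^sup>2) powr (p / 2 - 1) = \<bar>t\<bar> powr (p - 2)"
    by (simp add: square_powr right_diff_distrib)
  moreover have "t * \<bar>t\<bar> powr (p - 2) = sgn t * \<bar>t\<bar> powr (p - 1)"
  proof -
    have "t * \<bar>t\<bar> powr (p - 2) = sgn t * (\<bar>t\<bar> * \<bar>t\<bar> powr (p - 2))"
      by (simp only: mult_sgn_abs mult.assoc[symmetric])
    then show ?thesis using False by (simp add: powr_mult_base)
  qed
  ultimately show ?thesis by simp
qed (simp add: reg_pow_def)

lemma powr_half_square_limit: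
  assumes "0 < q"
  shows "((\<lambda>e::real. (t\<^sup>2 + e) powr (q / 2)) \<longlongrightarrow> \<bar>t\<bar> powr q) (at_right 0)"
proof -
  have "((\<lambda>e. (t\<^sup>2 + e) powr (q / 2)) \<longlongrightarrow> (t\<^sup>2 + 0) powr (q / 2)) (at_right 0)"
    using assms by (intro tendsto_powr' tendsto_intros)
       (auto simp: eventually_at_filter intro!: always_eventually)
  moreover have "(t\<^sup>2) powr (q / 2) = \<bar>t\<bar> powr q"
    by (simp add: square_powr)
  ultimately show ?thesis by simp
qed

lemma reg_pow_prim_limit:
  assumes "1 < p"
  shows "((\<lambda>e. reg_pow_prim p e t) \<longlongrightarrow> \<bar>t\<bar> powr p / p) (at_right 0)"
proof -
  have "((\<lambda>e. reg_pow_prim p e t) \<longlongrightarrow> (\<bar>t\<bar> powr p - \<bar>0\<bar> powr p) / p) (at_right 0)"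
    unfolding reg_pow_prim_def
    using tendsto_diff[OF powr_half_square_limit[of p t] powr_half_square_limit[of p 0]] assms
    by (intro tendsto_divide tendsto_const) simp_all
  then show ?thesis by simp
qed

lemma reg_pow_square_over_deriv_limit:
  assumes "1 < p"
  shows "((\<lambda>e. (reg_pow p e t)\<^sup>2 / reg_pow_deriv p e t) \<longlongrightarrow> \<bar>t\<bar> powr p / (p - 1)) (at_right 0)"
proof (cases "t = 0")
  case False
  have "((\<lambda>e. t\<^sup>2 / ((p - 1) * t\<^sup>2 + e) * (t\<^sup>2 + e) powr (p / 2)) \<longlongrightarrow>
      t\<^sup>2 / ((p - 1) * t\<^sup>2 + 0) * \<bar>t\<bar> powr p) (at_right 0)"
    using assms False by (intro tendsto_intros powr_half_square_limit) auto
  then have "((\<lambda>e. t\<^sup>2 / ((p - 1) * t\<^sup>2 + e) * (t\<^sup>2 + e) powr (p / 2)) \<longlongrightarrow>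
      \<bar>t\<bar> powr p / (p - 1)) (at_right 0)"
    using False by simp
  then show ?thesis
    by (rule Lim_transform_eventually)
       (simp add: eventually_at_filter reg_pow_square_over_deriv[OF _ assms])
qed (simp add: reg_pow_def)

text \<open>
  Up to the factor \<open>1 / (p - 1)\<close>, one majorant free of \<open>e\<close> serves every term that has to pass to
  the limit.
\<close>

lemma reg_pow_bounds:
  assumes e: "0 < e" "e \<le> 1" and p: "1 < p"
  shows "\<bar>reg_pow p e t\<bar> \<le> (t\<^sup>2 + 1) powr (p / 2)"
    and "\<bar>t * reg_pow p e t\<bar> \<le> (t\<^sup>2 + 1) powr (p / 2)"
    and "\<bar>reg_pow_prim p e t\<bar> \<le> (t\<^sup>2 + 1) powr (p / 2)"
    and "(reg_pow p e t)\<^sup>2 / reg_pow_deriv p e t \<le> (t\<^sup>2 + 1) powr (p / 2) / (p - 1)"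
proof -
  have pos: "0 < t\<^sup>2 + e" using e(1) by (rule sum_square_pos)
  have mono: "(t\<^sup>2 + e) powr q \<le> (t\<^sup>2 + 1) powr q" if "0 \<le> q" for q
    using that pos e by (intro powr_mono2) auto
  show "\<bar>reg_pow p e t\<bar> \<le> (t\<^sup>2 + 1) powr (p / 2)"
  proof -
    have "\<bar>t\<bar> = (t\<^sup>2) powr (1 / 2)" by (simp add: powr_half_sqrt)
    also have "\<dots> \<le> (t\<^sup>2 + e) powr (1 / 2)" using e by (intro powr_mono2) auto
    finally have "\<bar>reg_pow p e t\<bar> \<le> (t\<^sup>2 + e) powr (1 / 2) * (t\<^sup>2 + e) powr (p / 2 - 1)"
      by (simp add: reg_pow_def abs_mult mult_right_mono)
    also have "\<dots> = (t\<^sup>2 + e) powr ((p - 1) / 2)"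
      by (simp add: diff_divide_distrib flip: powr_add)
    also have "\<dots> \<le> (t\<^sup>2 + 1) powr ((p - 1) / 2)" using p by (intro mono) auto
    also have "\<dots> \<le> (t\<^sup>2 + 1) powr (p / 2)" by (intro powr_mono) auto
    finally show ?thesis .
  qed
  have "\<bar>t * reg_pow p e t\<bar> = t\<^sup>2 * (t\<^sup>2 + e) powr (p / 2 - 1)"
    by (simp add: reg_pow_def abs_mult power2_eq_square)
  also have "\<dots> \<le> (t\<^sup>2 + e) * (t\<^sup>2 + e) powr (p / 2 - 1)"
    using e by (intro mult_right_mono) auto
  also have "\<dots> = (t\<^sup>2 + e) powr (p / 2)" using pos by (simp add: powr_mult_base)
  also have "\<dots> \<le> (t\<^sup>2 + 1) powr (p / 2)" using p by (intro mono) auto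
  finally show "\<bar>t * reg_pow p e t\<bar> \<le> (t\<^sup>2 + 1) powr (p / 2)" .
  have "e powr (p / 2) \<le> (t\<^sup>2 + e) powr (p / 2)" using e p by (intro powr_mono2) auto
  then have "\<bar>reg_pow_prim p e t\<bar> \<le> (t\<^sup>2 + e) powr (p / 2) / p"
    using p by (simp add: reg_pow_prim_def divide_right_mono)
  also have "\<dots> \<le> (t\<^sup>2 + e) powr (p / 2)"
    using p by (simp add: divide_le_eq mult_le_cancel_left1)
  also have "\<dots> \<le> (t\<^sup>2 + 1) powr (p / 2)" using p by (intro mono) auto
  finally show "\<bar>reg_pow_prim p e t\<bar> \<le> (t\<^sup>2 + 1) powr (p / 2)" .
  have "t\<^sup>2 / ((p - 1) * t\<^sup>2 + e) \<le> 1 / (p - 1)"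
  proof -
    have "0 < (p - 1) * t\<^sup>2 + e" using e p by (intro add_nonneg_pos) auto
    then show ?thesis using e p by (simp add: divide_le_eq) (simp add: field_simps)
  qed
  then have "t\<^sup>2 / ((p - 1) * t\<^sup>2 + e) * (t\<^sup>2 + e) powr (p / 2) \<le> 1 / (p - 1) * (t\<^sup>2 + 1) powr (p / 2)"
    using e p by (intro mult_mono mono) auto
  then show "(reg_pow p e t)\<^sup>2 / reg_pow_deriv p e t \<le> (t\<^sup>2 + 1) powr (p / 2) / (p - 1)"
    using reg_pow_square_over_deriv[OF e(1) p] by simp
qed

section \<open>Radial weights and completing the square\<close>

lemma has_derivative_radial:
  fixes x :: "'a::real_inner"
  assumes "x \<noteq> 0" "(F has_real_derivative F') (at (norm x))"
  shows "((\<lambda>x. F (norm x)) has_derivative (\<lambda>v. (v \<bullet> x) * (F' / norm x))) (at x)"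
proof -
  have "(norm has_derivative (\<lambda>v. v \<bullet> sgn x)) (at x)"
    using GDERIV_norm[OF assms(1)] by (simp add: gderiv_def)
  from DERIV_compose_FDERIV[OF assms(2) this]
  show ?thesis by (simp add: sgn_div_norm divide_inverse mult_ac)
qed

lemma ln_ratio_neq_0:
  fixes r R :: real
  assumes "0 < r" "r < R"
  shows "ln (r / R) \<noteq> 0"
proof -
  have "0 < R" using assms by (rule less_trans)
  then show ?thesis using assms ln_less_zero[of "r / R"] by simp
qed

text \<open>
  The term \<open>\<nu> / (ln (r / R))\<^sup>2\<close> produced by differentiating \<open>1 / ln (r / R)\<close> is the source of the
  logarithmic remainder.
\<close>

lemma powr_log_weight_has_derivative:
  fixes r R q \<mu> \<nu> :: real
  assumes "0 < r" "r < R"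
  shows "((\<lambda>r. r powr q * (\<mu> + \<nu> / ln (r / R))) has_real_derivative
    r powr (q - 1) * (q * (\<mu> + \<nu> / ln (r / R)) - \<nu> / (ln (r / R))\<^sup>2)) (at r)"
proof -
  have ln: "ln (r / R) \<noteq> 0" using assms by (rule ln_ratio_neq_0)
  have 1: "((\<lambda>r. r powr q) has_real_derivative q * r powr (q - 1)) (at r)"
    using has_real_derivative_powr[OF assms(1)] .
  have "((\<lambda>r. ln (r / R)) has_real_derivative 1 / r) (at r)"
    using assms by (auto intro!: derivative_eq_intros)
  from DERIV_add[OF DERIV_const[of \<mu>] DERIV_cmult[OF DERIV_inverse_fun[OF this ln], of \<nu>]]
  have 2: "((\<lambda>r. \<mu> + \<nu> / ln (r / R)) has_real_derivative - \<nu> / (ln (r / R))\<^sup>2 * (1 / r)) (at r)"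
    by (simp add: divide_inverse power2_eq_square mult_ac)
  have r: "r powr q = r powr (q - 1) * r"
    using assms by (simp add: powr_mult_base mult.commute)
  have "q * r powr (q - 1) * (\<mu> + \<nu> / ln (r / R)) + - \<nu> / (ln (r / R))\<^sup>2 * (1 / r) * r powr q
      = r powr (q - 1) * (q * (\<mu> + \<nu> / ln (r / R)) - \<nu> / (ln (r / R))\<^sup>2)"
    unfolding r using assms by (simp add: right_diff_distrib)
  with DERIV_mult[OF 1 2] show ?thesis by simp
qed

lemma completed_square_nonneg:
  fixes d :: real
  assumes "0 < d" "X\<^sup>2 \<le> g"
  shows "0 \<le> d * g + 2 * h * f * X + h\<^sup>2 * (f\<^sup>2 / d)"
proof -
  have "d * X\<^sup>2 + 2 * h * f * X + h\<^sup>2 * (f\<^sup>2 / d) = (d * X + h * f)\<^sup>2 / d"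
    using assms by (simp add: field_simps power2_eq_square)
  moreover have "0 \<le> (d * X + h * f)\<^sup>2 / d" using assms by simp
  moreover have "d * X\<^sup>2 \<le> d * g" using assms by simp
  ultimately show ?thesis by linarith
qed

lemma powr_split_square:
  fixes r q :: real
  assumes "0 < r"
  shows "r powr q = r powr (q - 2) * r\<^sup>2"
proof -
  have "r powr (q - 2) * r\<^sup>2 = r powr (q - 2) * r powr 2" using assms by simp
  also have "\<dots> = r powr q" by (simp flip: powr_add)
  finally show ?thesis ..
qed

section \<open>The energy inequality\<close>

text \<open>
  The integrand \<open>E\<close> differs from a nonnegative function by two divergences: that of
  \<open>|x|\<^sup>\<beta> \<phi>(u) \<nabla>u\<close>, which removes the Laplacian, and that of \<open>|x|\<^bsup>\<beta>-2\<^esup> m \<Phi>(u) x\<close>, which removes the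
  part of the drift that is not completed to a square. The parameters \<open>\<mu>\<close> and \<open>\<nu>\<close> of the radial
  weight \<open>m\<close> stay free here; they are optimised later.
\<close>

lemma regularized_energy_inequality:
  fixes u :: "'a::euclidean_space \<Rightarrow> real" and p e \<beta> b c \<mu> \<nu> R :: real
  assumes p: "1 < p" and e: "0 < e" and K: "compact K" and sub: "K \<subseteq> {x. 0 < norm x \<and> norm x < R}"
    and u: "C2 u" and out: "\<And>x. x \<notin> K \<Longrightarrow> u x = 0"
  defines "l \<equiv> \<lambda>x. ln (norm x / R)"
  defines "m \<equiv> \<lambda>x. \<mu> + \<nu> / l x"
  defines "E \<equiv> \<lambda>x. - (norm x powr \<beta> * L_op b c u x * reg_pow p e (u x)) + norm x powr (\<beta> - 2) *
      (((real DIM('a) + \<beta> - 2) * m x - \<nu> / (l x)\<^sup>2) * reg_pow_prim p e (u x)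
       + ((\<beta> - c - m x) / 2)\<^sup>2 * ((reg_pow p e (u x))\<^sup>2 / reg_pow_deriv p e (u x))
       - b * (u x * reg_pow p e (u x)))"
  shows "integrable lborel E" "0 \<le> (\<integral>x. E x \<partial>lborel)"
proof -
  define U where "U = {x::'a. 0 < norm x \<and> norm x < R}"
  have "open U"
    unfolding U_def by (intro open_Collect_conj open_Collect_less continuous_intros)
  have KU: "K \<subseteq> U" using sub by (simp add: U_def)
  have U: "x \<noteq> 0" "0 < norm x" "norm x < R" "0 < R" "l x \<noteq> 0" if "x \<in> U" for x
  proof -
    show pos: "0 < norm x" "norm x < R" using that by (simp_all add: U_def)
    show "x \<noteq> 0" using pos(1) by simp
    show "0 < R" using pos by (rule less_trans)
    show "l x \<noteq> 0" unfolding l_def using pos by (rule ln_ratio_neq_0)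
  qed
  have cl: "continuous_on U l"
    unfolding l_def using U by (intro continuous_intros) force+
  have cm: "continuous_on U m"
    unfolding m_def using U by (intro continuous_intros cl) auto
  have cpow: "continuous_on U (\<lambda>x. norm x powr q)" for q
    using U by (intro continuous_intros) auto
  have cu: "continuous_on S u" "continuous_on S (\<lambda>x. reg_pow p e (u x))"
    "continuous_on S (\<lambda>x. reg_pow_deriv p e (u x))"
    "continuous_on S (\<lambda>x. reg_pow_prim p e (u x))" for S
  proof -
    have "continuous_on UNIV (reg_pow_prim p e)"
      by (intro continuous_at_imp_continuous_on ballI
          DERIV_isCont[OF reg_pow_prim_has_derivative[OF e p]])
    then show "continuous_on S (\<lambda>x. reg_pow_prim p e (u x))"
      by (rule continuous_on_compose2[OF _ C2_continuous[OF u]]) simp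
    show "continuous_on S (\<lambda>x. reg_pow p e (u x))"
      by (rule continuous_on_compose2[OF continuous_reg_pow[OF e] C2_continuous[OF u] subset_UNIV])
    show "continuous_on S (\<lambda>x. reg_pow_deriv p e (u x))"
      by (rule continuous_on_compose2[OF continuous_reg_pow_deriv[OF e] C2_continuous[OF u] subset_UNIV])
  qed (rule C2_continuous[OF u])
  have dpos: "0 < reg_pow_deriv p e t" for t using reg_pow_deriv_pos[OF e p] .
  have zero: "reg_pow p e 0 = 0" "reg_pow_prim p e 0 = 0"
    by (simp_all add: reg_pow_def reg_pow_prim_def)
  have E0: "E x = 0" if "x \<notin> K" for x
    using out[OF that] by (simp add: E_def zero)
  have cE: "continuous_on U E"
    unfolding E_def
  proof (intro continuous_intros cl cm cpow cu C2_continuous_L_op u)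
    show "0 \<notin> U" "\<forall>x\<in>U. (l x)\<^sup>2 \<noteq> 0" using U by auto
    show "\<forall>x\<in>U. reg_pow_deriv p e (u x) \<noteq> 0" using dpos by (simp add: less_imp_neq[symmetric])
  qed (simp_all add: U_def)
  show intE: "integrable lborel E"
    using integrable_compact_support[OF K continuous_on_subset[OF cE KU]] E0 by blast

  define a' where "a' x v = (v \<bullet> x) * (\<beta> * norm x powr (\<beta> - 2))" for x v :: 'a
  define k where "k x = norm x powr (\<beta> - 2) * m x" for x
  define k' where "k' x v = (v \<bullet> x) * (norm x powr (\<beta> - 4) * ((\<beta> - 2) * m x - \<nu> / (l x)\<^sup>2))"
    for x v :: 'a
  have powr_div: "norm x powr (q - 1) / norm x = norm x powr (q - 2)" if "x \<in> U" for x q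
    using powr_diff[of "norm x" "q - 1" 1] U[OF that] by simp
  have a: "((\<lambda>x. norm x powr \<beta>) has_derivative a' x) (at x)" if "x \<in> U" for x
    using has_derivative_radial[OF U(1)[OF that] has_real_derivative_powr[OF U(2)[OF that]], of \<beta>]
      powr_div[OF that, of \<beta>]
    by (simp add: a'_def[abs_def] flip: times_divide_eq_right)
  have kder: "(k has_derivative k' x) (at x)" if "x \<in> U" for x
    using has_derivative_radial[OF U(1)[OF that]
        powr_log_weight_has_derivative[OF U(2,3)[OF that], of "\<beta> - 2" \<mu> \<nu>]]
      powr_div[OF that, of "\<beta> - 2"]
    by (simp add: k_def[abs_def] k'_def[abs_def] m_def l_def flip: times_divide_eq_left)
  have ca': "continuous_on U (\<lambda>x. a' x i)" for i
    unfolding a'_def by (intro continuous_intros cpow)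
  have ck': "continuous_on U (\<lambda>x. k' x i)" for i
    unfolding k'_def using U by (intro continuous_intros cpow cl cm) auto
  define G where "G x = norm x powr \<beta> * reg_pow p e (u x) * laplacian u x
      + norm x powr \<beta> * reg_pow_deriv p e (u x) * (norm (grad u x))\<^sup>2
      + reg_pow p e (u x) * a' x (grad u x)" for x
  define H where "H x = k x * reg_pow p e (u x) * (x \<bullet> grad u x)
      + (k' x x + real DIM('a) * k x) * reg_pow_prim p e (u x)" for x
  have G: "integrable lborel G" "(\<integral>x. G x \<partial>lborel) = 0"
    using integral_green[OF \<open>open U\<close> K KU u out a ca' reg_pow_has_derivative[OF e]
        continuous_reg_pow_deriv[OF e] zero(1)]
    by (simp_all add: G_def[abs_def])
  have H: "integrable lborel H" "(\<integral>x. H x \<partial>lborel) = 0"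
    using integral_radial_field[OF \<open>open U\<close> K KU u out kder ck' reg_pow_prim_has_derivative[OF e p]
        continuous_reg_pow[OF e] zero(2)]
    by (simp_all add: H_def[abs_def])
  have "0 \<le> E x + G x - H x" for x
  proof (cases "x \<in> K")
    case False
    \<comment> \<open>Of the three functions only \<open>G\<close> may survive, through its term in \<open>reg_pow_deriv\<close>, which is nonnegative.\<close>
    then show ?thesis
      using E0[OF False] out[OF False] dpos[of 0] by (simp add: G_def H_def zero)
  next
    case True
    then have x: "x \<in> U" using KU by blast
    \<comment> \<open>Only the radial part \<open>X / |x|\<close> of the gradient is kept; then \<open>h\<close> completes the square.\<close>
    define w where "w = norm x powr (\<beta> - 2)"
    define X where "X = x \<bullet> grad u x"
    define f where "f = reg_pow p e (u x)"
    define d where "d = reg_pow_deriv p e (u x)"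
    define h where "h = (\<beta> - c - m x) / 2"
    have "X\<^sup>2 \<le> (norm x)\<^sup>2 * (norm (grad u x))\<^sup>2"
      using Cauchy_Schwarz_ineq[of x "grad u x"] by (simp add: X_def power2_norm_eq_inner)
    then have "0 \<le> w * (d * ((norm x)\<^sup>2 * (norm (grad u x))\<^sup>2) + 2 * h * f * X + h\<^sup>2 * (f\<^sup>2 / d))"
      using completed_square_nonneg dpos by (intro mult_nonneg_nonneg) (auto simp: w_def d_def)
    also have "\<dots> = E x + G x - H x"
    proof -
      have pw: "norm x powr \<beta> = w * (norm x)\<^sup>2"
        unfolding w_def by (rule powr_split_square[OF U(2)[OF x]])
      have "norm x powr (\<beta> - 4) * (norm x)\<^sup>2 = w"
        unfolding w_def using powr_split_square[OF U(2)[OF x], of "\<beta> - 2"] by simp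
      then have kx: "k' x x = w * ((\<beta> - 2) * m x - \<nu> / (l x)\<^sup>2)"
        by (simp add: k'_def flip: power2_norm_eq_inner) (simp add: algebra_simps)
      have L: "(norm x)\<^sup>2 * L_op b c u x = (norm x)\<^sup>2 * laplacian u x + c * X - b * u x"
        using U[OF x] by (simp add: L_op_def X_def right_diff_distrib distrib_left)
      have Ex: "E x = - (w * ((norm x)\<^sup>2 * L_op b c u x) * f)
          + w * (((real DIM('a) + \<beta> - 2) * m x - \<nu> / (l x)\<^sup>2) * reg_pow_prim p e (u x)
            + h\<^sup>2 * (f\<^sup>2 / d) - b * (u x * f))"
        by (simp add: E_def pw f_def d_def h_def w_def[symmetric])
      have Gx: "G x = w * (norm x)\<^sup>2 * f * laplacian u x
          + w * (norm x)\<^sup>2 * d * (norm (grad u x))\<^sup>2 + f * (X * (\<beta> * w))"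
        by (simp add: G_def pw f_def d_def a'_def X_def w_def[symmetric] inner_commute)
      have Hx: "H x = w * m x * f * X + (w * ((\<beta> - 2) * m x - \<nu> / (l x)\<^sup>2)
          + real DIM('a) * (w * m x)) * reg_pow_prim p e (u x)"
        by (simp add: H_def kx k_def f_def X_def w_def)
      have h2: "2 * h = \<beta> - c - m x" by (simp add: h_def)
      show ?thesis unfolding Ex Gx Hx L h2 by (simp add: algebra_simps)
    qed
    finally show ?thesis .
  qed
  then have "0 \<le> (\<integral>x. E x + G x - H x \<partial>lborel)" by (intro integral_nonneg_AE AE_I2)
  then show "0 \<le> (\<integral>x. E x \<partial>lborel)" using intE G H by simp
qed

text \<open>
  The limit \<open>e \<rightarrow> 0\<close> of \<open>regularized_energy_inequality\<close>. The weights are continuous on \<open>K\<close> and the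
  regularised powers of \<open>u\<close> are bounded there uniformly in \<open>e\<close>, so the limit passes under the integral.
\<close>

lemma energy_inequality:
  fixes u :: "'a::euclidean_space \<Rightarrow> real" and p \<beta> b c \<mu> \<nu> R :: real
  assumes p: "1 < p" and K: "compact K" and sub: "K \<subseteq> {x. 0 < norm x \<and> norm x < R}"
    and u: "C2 u" and out: "\<And>x. x \<notin> K \<Longrightarrow> u x = 0"
  defines "l \<equiv> \<lambda>x. ln (norm x / R)"
  defines "m \<equiv> \<lambda>x. \<mu> + \<nu> / l x"
  defines "E \<equiv> \<lambda>x. - (norm x powr \<beta> * L_op b c u x * (sgn (u x) * \<bar>u x\<bar> powr (p - 1)))
      + norm x powr (\<beta> - 2) *
      (((real DIM('a) + \<beta> - 2) * m x - \<nu> / (l x)\<^sup>2) * (\<bar>u x\<bar> powr p / p)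
       + ((\<beta> - c - m x) / 2)\<^sup>2 * (\<bar>u x\<bar> powr p / (p - 1))
       - b * \<bar>u x\<bar> powr p)"
  shows "integrable lborel E" "0 \<le> (\<integral>x. E x \<partial>lborel)"
proof -
  define F where "F e x = - (norm x powr \<beta> * L_op b c u x * reg_pow p e (u x)) + norm x powr (\<beta> - 2) *
      (((real DIM('a) + \<beta> - 2) * m x - \<nu> / (l x)\<^sup>2) * reg_pow_prim p e (u x)
       + ((\<beta> - c - m x) / 2)\<^sup>2 * ((reg_pow p e (u x))\<^sup>2 / reg_pow_deriv p e (u x))
       - b * (u x * reg_pow p e (u x)))" for e x
  have F: "integrable lborel (F e)" "0 \<le> (\<integral>x. F e x \<partial>lborel)" if "0 < e" for e
    using regularized_energy_inequality[OF p that K sub u out, of \<beta> b c \<mu> \<nu>]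
    by (simp_all add: F_def[abs_def] m_def l_def)
  define B where "B x = ((u x)\<^sup>2 + 1) powr (p / 2)" for x
  \<comment> \<open>An integrable majorant on \<open>K\<close> for all \<open>0 < e \<le> 1\<close>, obtained by replacing every factor that depends on \<open>e\<close> by its bound.\<close>
  define W where "W x = \<bar>norm x powr \<beta> * L_op b c u x\<bar> * B x + norm x powr (\<beta> - 2) *
      (\<bar>(real DIM('a) + \<beta> - 2) * m x - \<nu> / (l x)\<^sup>2\<bar> * B x
       + ((\<beta> - c - m x) / 2)\<^sup>2 * (B x / (p - 1)) + \<bar>b\<bar> * B x)" for x
  have l: "l x \<noteq> 0" "x \<noteq> 0" "0 < norm x / R" if "x \<in> K" for x
  proof -
    have x: "0 < norm x" "norm x < R" using sub that by auto
    show "l x \<noteq> 0" unfolding l_def using x by (rule ln_ratio_neq_0)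
    show "x \<noteq> 0" using x(1) by simp
    have "0 < R" using x by (rule less_trans)
    then show "0 < norm x / R" using x(1) by simp
  qed
  have cl: "continuous_on K l"
    unfolding l_def using l(3) by (intro continuous_intros) force+
  have cm: "continuous_on K m"
    unfolding m_def using l by (intro continuous_intros cl) auto
  have cpow: "continuous_on K (\<lambda>x. norm x powr q)" for q
    using l by (intro continuous_intros) auto
  have "0 \<notin> K" using l(2) by blast
  have cB: "continuous_on K B"
  proof -
    have "t\<^sup>2 + 1 \<noteq> (0::real)" for t using sum_square_pos[of 1 t] by simp
    then show ?thesis unfolding B_def by (intro continuous_intros C2_continuous u) auto
  qed
  have cW: "continuous_on K W"
    unfolding W_def using p l
    by (intro continuous_intros cl cm cpow cB C2_continuous_L_op[OF u \<open>0 \<notin> K\<close>]) auto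
  have FE: "((\<lambda>e. F e x) \<longlongrightarrow> E x) (at_right 0)" for x
  proof -
    have "((\<lambda>e. u x * reg_pow p e (u x)) \<longlongrightarrow> u x * (sgn (u x) * \<bar>u x\<bar> powr (p - 1))) (at_right 0)"
      by (intro tendsto_intros reg_pow_limit p)
    also have "u x * (sgn (u x) * \<bar>u x\<bar> powr (p - 1)) = \<bar>u x\<bar> * \<bar>u x\<bar> powr (p - 1)"
      by (simp add: abs_sgn)
    also have "\<dots> = \<bar>u x\<bar> powr p" using p by (simp add: powr_mult_base)
    finally show ?thesis
      unfolding F_def E_def
      by (intro tendsto_add tendsto_diff tendsto_mult tendsto_minus tendsto_const
          reg_pow_limit reg_pow_prim_limit reg_pow_square_over_deriv_limit p)
  qed
  have bound: "\<bar>F e x\<bar> \<le> indicator K x *\<^sub>R W x" if e: "0 < e" "e \<le> 1" for e x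
  proof (cases "x \<in> K")
    case False
    then show ?thesis using out by (simp add: F_def reg_pow_def reg_pow_prim_def)
  next
    case True
    note bd = reg_pow_bounds[OF e p, of "u x"]
    define f g where "f = reg_pow p e (u x)" and "g = reg_pow_prim p e (u x)"
    define q where "q = f\<^sup>2 / reg_pow_deriv p e (u x)"
    have q: "0 \<le> q" using reg_pow_deriv_pos[OF e(1) p, of "u x"] by (simp add: q_def)
    define A P w h2 where "A = norm x powr \<beta> * L_op b c u x"
      and "P = (real DIM('a) + \<beta> - 2) * m x - \<nu> / (l x)\<^sup>2"
      and "w = norm x powr (\<beta> - 2)" and "h2 = ((\<beta> - c - m x) / 2)\<^sup>2"
    have "\<bar>F e x\<bar> = \<bar>- (A * f) + w * (P * g + h2 * q - b * (u x * f))\<bar>"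
      by (simp add: F_def A_def P_def w_def h2_def f_def g_def q_def)
    also have "\<dots> \<le> \<bar>A * f\<bar> + \<bar>w * (P * g + h2 * q - b * (u x * f))\<bar>" by arith
    also have "\<bar>w * (P * g + h2 * q - b * (u x * f))\<bar> = w * \<bar>P * g + h2 * q - b * (u x * f)\<bar>"
      by (simp add: abs_mult w_def)
    also have "\<bar>P * g + h2 * q - b * (u x * f)\<bar> \<le> \<bar>P * g\<bar> + \<bar>h2 * q\<bar> + \<bar>b * (u x * f)\<bar>" by arith
    also have "\<bar>h2 * q\<bar> = h2 * q" using q by (simp add: h2_def)
    finally have "\<bar>F e x\<bar> \<le> \<bar>A\<bar> * \<bar>f\<bar> + w * (\<bar>P\<bar> * \<bar>g\<bar> + h2 * q + \<bar>b\<bar> * \<bar>u x * f\<bar>)"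
      by (simp add: abs_mult w_def mult_left_mono)
    also have "\<dots> \<le> \<bar>A\<bar> * B x + w * (\<bar>P\<bar> * B x + h2 * (B x / (p - 1)) + \<bar>b\<bar> * B x)"
      using bd by (intro add_mono mult_left_mono) (auto simp: B_def f_def g_def q_def h2_def w_def)
    also have "\<dots> = indicator K x *\<^sub>R W x"
      using True by (simp add: W_def A_def P_def w_def h2_def)
    finally show ?thesis .
  qed
  define e where "e n = 1 / real (Suc n)" for n
  have e: "0 < e n" "e n \<le> 1" for n by (simp_all add: e_def)
  have "e \<longlonglongrightarrow> 0"
    unfolding e_def using LIMSEQ_inverse_real_of_nat by (simp add: inverse_eq_divide)
  then have e_lim: "filterlim e (at_right 0) sequentially"
    using e by (intro tendsto_imp_filterlim_at_right) auto
  have lim: "(\<lambda>n. F (e n) x) \<longlonglongrightarrow> E x" for x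
    using filterlim_compose[OF FE e_lim] .
  have meas: "F (e n) \<in> borel_measurable lborel" for n
    using F(1)[OF e(1)] by (rule borel_measurable_integrable)
  have measE: "E \<in> borel_measurable lborel"
    by (rule borel_measurable_LIMSEQ_real[OF lim meas])
  have intW: "integrable lborel (\<lambda>x. indicator K x *\<^sub>R W x)"
    by (rule borel_integrable_compact[OF K cW])
  have ae: "AE x in lborel. (\<lambda>n. F (e n) x) \<longlonglongrightarrow> E x" using lim by simp
  have ab: "AE x in lborel. norm (F (e n) x) \<le> indicator K x *\<^sub>R W x" for n
    using bound[OF e] by simp
  show "integrable lborel E"
    by (rule integrable_dominated_convergence[OF measE meas intW ae ab])
  have "(\<lambda>n. \<integral>x. F (e n) x \<partial>lborel) \<longlonglongrightarrow> (\<integral>x. E x \<partial>lborel)"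
    by (rule integral_dominated_convergence[OF measE meas intW ae ab])
  then show "0 \<le> (\<integral>x. E x \<partial>lborel)"
    using F(2)[OF e(1)] by (intro LIMSEQ_le_const) auto
qed

section \<open>The weighted Rellich inequality with logarithmic remainder\<close>

text \<open>
  The choice of \<open>\<mu>\<close> and \<open>\<nu>\<close>. Writing \<open>h = (\<beta> - c - m) / 2 = (p - 1) (s - 1 / (p l))\<close>, the value
  \<open>(p - 1) s\<close> is the maximiser of the concave quadratic that results from a constant \<open>h\<close>; the terms
  of order \<open>1 / l\<close> then cancel, and the coefficient \<open>1 / p\<close> of \<open>1 / l\<close> maximises what is left at order
  \<open>1 / l\<^sup>2\<close>, namely \<open>2 a / p - a\<^sup>2 / (p - 1)\<close> at \<open>a = (p - 1) / p\<close>.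
\<close>

lemma optimal_coefficient:
  fixes s \<beta> b c p l n :: real
  assumes p: "1 < p" and l: "l \<noteq> 0" and n: "n + \<beta> - 2 = p * s"
  defines "m \<equiv> (\<beta> - c - 2 * (p - 1) * s) + (2 * (p - 1) / p) / l"
  shows "((n + \<beta> - 2) * m - (2 * (p - 1) / p) / l\<^sup>2) / p + ((\<beta> - c - m) / 2)\<^sup>2 / (p - 1) - b
    = - (b + s * (n - 2 + c - s) + (p - 1) / p\<^sup>2 / l\<^sup>2)"
proof -
  have h: "(\<beta> - c - m) / 2 = (p - 1) * (s - 1 / (p * l))"
    using p l by (simp add: m_def field_simps)
  have h2: "((\<beta> - c - m) / 2)\<^sup>2 / (p - 1) = (p - 1) * (s - 1 / (p * l))\<^sup>2"
    unfolding h using p by (simp add: power_mult_distrib power2_eq_square)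
  have b: "\<beta> = p * s - n + 2" using n by simp
  show ?thesis unfolding h2 n unfolding m_def b using p l
    by (simp add: field_simps power2_eq_square)
qed

theorem theorem7p3:
  fixes N p p' \<alpha> b c D C :: real
  assumes N: "N = real DIM('a::euclidean_space)" and "N \<ge> 2"
    and p: "1 < p"
    and D: "D = b + ((N - 2 + c) / 2)\<^sup>2" and "D > 0"
    and lower: "N * (1 / 2 - 1 / p) + 1 + c / 2 - sqrt D < \<alpha>"
    and upper: "\<alpha> < N * (1 / 2 - 1 / p) + 1 + c / 2 + sqrt D"
    and p': "1 / p + 1 / p' = 1"
    and C: "C = b + (N / p - 2 + \<alpha>) * (N / p' - \<alpha> + c)"
  shows "\<exists>\<kappa>>0. \<forall>R>0. \<forall>u \<in> (D_class R :: ('a \<Rightarrow> real) set).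
           (Lp_norm p (\<lambda>x. norm x powr \<alpha> * L_op b c u x)) powr p
             - C powr p * (Lp_norm p (\<lambda>x. norm x powr (\<alpha> - 2) * u x)) powr p
           \<ge> \<kappa> * (Lp_norm p (\<lambda>x. norm x powr (\<alpha> - 2)
                     * \<bar>ln (norm ((1 / R) *\<^sub>R x))\<bar> powr (- (2 / p)) * u x)) powr p"
proof -
  define s where "s = N / p - 2 + \<alpha>"
  \<comment> \<open>The exponent for which \<open>|x|\<^sup>\<alpha> L u\<close> times \<open>(|x|\<^bsup>\<alpha>-2\<^esup> |u|)\<^bsup>p-1\<^esup>\<close> carries the weight \<open>|x|\<^sup>\<beta>\<close>.\<close>
  define \<beta> where "\<beta> = (\<alpha> - 2) * p + 2"
  have N_\<beta>: "real DIM('a) + \<beta> - 2 = p * s"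
    using p by (simp add: s_def \<beta>_def N[symmetric] field_simps)
  have C_s: "C = b + s * (real DIM('a) - 2 + c - s)"
  proof -
    have "N / p' = N * (1 / p')" by simp
    also have "1 / p' = 1 - 1 / p" using p' by simp
    finally have "N / p' - \<alpha> + c = N - 2 + c - s" by (simp add: s_def right_diff_distrib)
    then show ?thesis by (simp add: C s_def N)
  qed
  have "0 < C"
  proof -
    have "\<bar>s - (N - 2 + c) / 2\<bar> < sqrt D"
      using lower upper by (simp add: s_def right_diff_distrib abs_less_iff) (simp add: field_simps)
    then have "\<bar>s - (N - 2 + c) / 2\<bar>\<^sup>2 < (sqrt D)\<^sup>2" by (intro power_strict_mono) auto
    then have "(s - (N - 2 + c) / 2)\<^sup>2 < D" using \<open>D > 0\<close> by simp
    moreover have "C = D - (s - (N - 2 + c) / 2)\<^sup>2"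
      unfolding C_s D N[symmetric] by (simp add: power2_eq_square field_simps)
    ultimately show ?thesis by simp
  qed
  define \<gamma> where "\<gamma> = (p - 1) / p\<^sup>2"
  define \<kappa> where "\<kappa> = p * C powr (p - 1) * \<gamma>"
  have "0 < \<kappa>" using p \<open>0 < C\<close> by (simp add: \<kappa>_def \<gamma>_def)
  moreover have "(Lp_norm p (\<lambda>x. norm x powr \<alpha> * L_op b c u x)) powr p
             - C powr p * (Lp_norm p (\<lambda>x. norm x powr (\<alpha> - 2) * u x)) powr p
           \<ge> \<kappa> * (Lp_norm p (\<lambda>x. norm x powr (\<alpha> - 2)
                     * \<bar>ln (norm ((1 / R) *\<^sub>R x))\<bar> powr (- (2 / p)) * u x)) powr p"
    if R: "R > 0" and uR: "u \<in> D_class R" for R and u :: "'a \<Rightarrow> real"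
  proof -
    have u: "C2 u" using uR by (simp add: D_class_def)
    obtain K where K: "compact K" "K \<subseteq> {x. 0 < norm x \<and> norm x < R}"
      and out: "\<And>x. x \<notin> K \<Longrightarrow> u x = 0"
      using D_class_support[OF R uR] by blast
    have pos: "0 < norm x" "x \<noteq> 0" "ln (norm x / R) \<noteq> 0" if "x \<in> K" for x
    proof -
      have x: "0 < norm x" "norm x < R" using K(2) that by auto
      show "0 < norm x" by fact
      then show "x \<noteq> 0" by simp
      show "ln (norm x / R) \<noteq> 0" using x by (rule ln_ratio_neq_0)
    qed
    have Lout: "L_op b c u x = 0" if "x \<notin> K" for x
      using L_op_zero_off_support[OF compact_imp_closed[OF K(1)] u out that] .
    define I1 I2 I3 where "I1 x = \<bar>norm x powr \<alpha> * L_op b c u x\<bar> powr p"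
      and "I2 x = \<bar>norm x powr (\<alpha> - 2) * u x\<bar> powr p"
      and "I3 x = \<bar>norm x powr (\<alpha> - 2) * \<bar>ln (norm ((1 / R) *\<^sub>R x))\<bar> powr (- (2 / p)) * u x\<bar> powr p"
    for x
    have "0 \<notin> K" using pos(2) by blast
    have cpow: "continuous_on K (\<lambda>x. norm x powr q)" for q
      using pos by (intro continuous_intros) auto
    have cln: "continuous_on K (\<lambda>x. ln (norm ((1 / R) *\<^sub>R x)))"
      using pos \<open>R > 0\<close> by (intro continuous_intros) auto
    have lnz: "\<forall>x\<in>K. \<bar>ln (norm ((1 / R) *\<^sub>R x))\<bar> \<noteq> 0"
      using pos(3) \<open>R > 0\<close> by simp
    have cabs: "continuous_on K (\<lambda>x. \<bar>f x\<bar> powr p)" if "continuous_on K f" for f :: "'a \<Rightarrow> real"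
      using p that by (intro continuous_on_powr' continuous_intros) auto
    have int: "integrable lborel I1" "integrable lborel I2" "integrable lborel I3"
      unfolding I1_def[abs_def] I2_def[abs_def] I3_def[abs_def]
      by (rule integrable_compact_support[OF K(1)],
          intro cabs continuous_intros cpow cln lnz C2_continuous_L_op C2_continuous u \<open>0 \<notin> K\<close>,
          simp add: Lout out)+
    define \<mu> \<nu> where "\<mu> = \<beta> - c - 2 * (p - 1) * s" and "\<nu> = 2 * (p - 1) / p"
    define l m where "l x = ln (norm x / R)" and "m x = \<mu> + \<nu> / l x" for x :: 'a
    define E where "E x = - (norm x powr \<beta> * L_op b c u x * (sgn (u x) * \<bar>u x\<bar> powr (p - 1)))
      + norm x powr (\<beta> - 2) *
      (((real DIM('a) + \<beta> - 2) * m x - \<nu> / (l x)\<^sup>2) * (\<bar>u x\<bar> powr p / p)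
       + ((\<beta> - c - m x) / 2)\<^sup>2 * (\<bar>u x\<bar> powr p / (p - 1))
       - b * \<bar>u x\<bar> powr p)" for x
    have E: "integrable lborel E" "0 \<le> (\<integral>x. E x \<partial>lborel)"
      using energy_inequality[OF p K u out, of \<beta> b c \<mu> \<nu>]
      by (simp_all add: E_def[abs_def] m_def l_def)
    have point: "p * C powr (p - 1) * E x \<le> I1 x - C powr p * I2 x - \<kappa> * I3 x" for x
    proof (cases "x \<in> K")
      case False
      then show ?thesis using p by (simp add: E_def I1_def I2_def I3_def out Lout)
    next
      case True
      define w where "w = norm x powr (\<beta> - 2)"
      have I2: "I2 x = w * \<bar>u x\<bar> powr p"
        by (simp add: I2_def w_def \<beta>_def abs_mult powr_mult powr_powr)
      have I3: "I3 x = w * \<bar>u x\<bar> powr p / (l x)\<^sup>2"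
      proof -
        have "ln (norm ((1 / R) *\<^sub>R x)) = l x" using \<open>R > 0\<close> by (simp add: l_def)
        moreover have "(\<bar>l x\<bar> powr (- (2 / p))) powr p = 1 / (l x)\<^sup>2"
        proof -
          have "(\<bar>l x\<bar> powr (- (2 / p))) powr p = \<bar>l x\<bar> powr (- 2)"
            using p by (simp only: powr_powr) simp
          also have "\<dots> = 1 / (l x)\<^sup>2" by (simp add: powr_minus_divide)
          finally show ?thesis .
        qed
        ultimately show ?thesis
          by (simp add: I3_def w_def \<beta>_def abs_mult powr_mult powr_powr)
      qed
      have pair: "norm x powr \<alpha> * L_op b c u x * sgn (norm x powr (\<alpha> - 2) * u x)
            * \<bar>norm x powr (\<alpha> - 2) * u x\<bar> powr (p - 1)
          = norm x powr \<beta> * L_op b c u x * (sgn (u x) * \<bar>u x\<bar> powr (p - 1))"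
      proof -
        have "norm x powr \<alpha> * (norm x powr (\<alpha> - 2)) powr (p - 1) = norm x powr \<beta>"
          by (simp add: powr_powr \<beta>_def algebra_simps flip: powr_add)
        moreover have "sgn (norm x powr (\<alpha> - 2) * u x) = sgn (u x)"
          using pos[OF True] by (simp add: sgn_mult)
        ultimately show ?thesis by (simp add: abs_mult powr_mult mult_ac)
      qed
      have "E x = - (norm x powr \<beta> * L_op b c u x * (sgn (u x) * \<bar>u x\<bar> powr (p - 1)))
          + w * \<bar>u x\<bar> powr p * (((real DIM('a) + \<beta> - 2) * m x - \<nu> / (l x)\<^sup>2) / p
            + ((\<beta> - c - m x) / 2)\<^sup>2 / (p - 1) - b)"
      proof -
        have "P * (z / p) + H * (z / (p - 1)) - b * z = z * (P / p + H / (p - 1) - b)" for P H z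
          by (simp add: algebra_simps)
        then show ?thesis by (simp only: E_def w_def mult.assoc)
      qed
      also have "((real DIM('a) + \<beta> - 2) * m x - \<nu> / (l x)\<^sup>2) / p
            + ((\<beta> - c - m x) / 2)\<^sup>2 / (p - 1) - b = - (C + \<gamma> / (l x)\<^sup>2)"
        using optimal_coefficient[OF p _ N_\<beta>, of "l x" c b] pos(3)[OF True]
        by (simp add: m_def \<mu>_def \<nu>_def C_s \<gamma>_def l_def)
      finally have "E x = - (norm x powr \<alpha> * L_op b c u x) * sgn (norm x powr (\<alpha> - 2) * u x)
            * \<bar>norm x powr (\<alpha> - 2) * u x\<bar> powr (p - 1) - C * I2 x - \<gamma> * I3 x"
        unfolding mult_minus_left pair by (simp add: I2 I3 algebra_simps)
      then have "p * C powr (p - 1) * E x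
          = p * C powr (p - 1) * (- (norm x powr \<alpha> * L_op b c u x)
              * sgn (norm x powr (\<alpha> - 2) * u x) * \<bar>norm x powr (\<alpha> - 2) * u x\<bar> powr (p - 1)
              - C * I2 x) - \<kappa> * I3 x"
        by (simp only: \<kappa>_def right_diff_distrib mult_ac)
      also have "\<dots> \<le> I1 x - C powr p * I2 x - \<kappa> * I3 x"
        using powr_gap_ge_duality_pairing[OF p \<open>0 < C\<close>, of "- (norm x powr \<alpha> * L_op b c u x)"
            "norm x powr (\<alpha> - 2) * u x"]
        by (simp only: I1_def I2_def abs_minus_cancel diff_right_mono)
      finally show ?thesis .
    qed
    have "0 \<le> (\<integral>x. p * C powr (p - 1) * E x \<partial>lborel)" using E p by simp
    also have "\<dots> \<le> (\<integral>x. I1 x - C powr p * I2 x - \<kappa> * I3 x \<partial>lborel)"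
      using E int point by (intro integral_mono) auto
    also have "\<dots> = (\<integral>x. I1 x \<partial>lborel) - C powr p * (\<integral>x. I2 x \<partial>lborel) - \<kappa> * (\<integral>x. I3 x \<partial>lborel)"
      using int by simp
    finally show ?thesis
      using p by (simp add: Lp_norm_powr I1_def I2_def I3_def)
  qed
  ultimately show ?thesis by blast
qed

end
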